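(* Let $n\ge 1$. An Ulam set $\mathcal{U}$ in $\mathbb{Z}\times (\mathbb{Z}/n\mathbb{Z})$ is regular if and only if there exists a regular subset $E\subset \mathbb{Z}\times (\mathbb{Z}/n\mathbb{Z})$ such that the sum of two elements of $E$ is never in $E$ (i.e. $e_1+e_2\notin E$ for all $e_1,e_2\in E$) and only finitely many elements of $\mathcal{U}$ are not in $E$.
   Context: An Ulam set in $\mathbb{Z}\times(\mathbb{Z}/n\mathbb{Z})$ is a set $\mathcal{U}(S)$ obtained from a finite initial set $S\subset \mathbb{Z}\times(\mathbb{Z}/n\mathbb{Z})$ all of whose elements have strictly positive first coordinate, as follows. The size of $(x,y)$ is $x$. First put the elements of $S$ into $\mathcal{U}(S)$; then repeatedly add a smallest (in size) element not already in $\mathcal{U}(S)$ that is uniquely represented as the sum of two distinct elements already in $\mathcal{U}(S)$ (with $p+q$ and $q+p$ considered the same representation). Ties in size may be broken arbitrarily without affecting the resulting set. Equivalently, an element not in $S$ belongs to $\mathcal{U}(S)$ iff it equals $p+q$ for exactly one unordered pair $\{p,q\}$ of distinct elements of $\mathcal{U}(S)$. A set $\mathcal{S}\subset\mathbb{Z}\times(\mathbb{Z}/n\mathbb{Z})$ is regular if there exists a period $P>0$ such that, for all sufficiently large $x$ (and all $y$), $(x,y)\in\mathcal{S}$ if and only if $(x+P,y)\in\mathcal{S}$. *)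

theory Defs
  imports "HOL-Algebra.Elementary_Groups"
begin

(* \<int> \<times> (\<int>/n\<int>) with residues 0, ..., n - 1. HOL-Algebra writes the group operation multiplicatively:
   below, p \<otimes> q is the sum p + q. *)
abbreviation int_times_mod :: "nat \<Rightarrow> (int \<times> int) monoid"
  where "int_times_mod n \<equiv> integer_group \<times>\<times> integer_mod_group n"

definition size_of :: "int \<times> int \<Rightarrow> int"
  where "size_of z = fst z"

definition uniquely_represented :: "nat \<Rightarrow> (int \<times> int) set \<Rightarrow> int \<times> int \<Rightarrow> bool"
  where "uniquely_represented n A z \<longleftrightarrow>
    (\<exists>!R. \<exists>p\<in>A. \<exists>q\<in>A. p \<noteq> q \<and> R = {p, q} \<and> z = p \<otimes>\<^bsub>int_times_mod n\<^esub> q)"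

definition ulam_candidates :: "nat \<Rightarrow> (int \<times> int) set \<Rightarrow> (int \<times> int) set"
  where "ulam_candidates n A =
    {z \<in> carrier (int_times_mod n). z \<notin> A \<and> uniquely_represented n A z}"

(* One step of the construction, with an arbitrary choice among the smallest candidates;
   if there is no candidate the construction has stopped and the set no longer changes. *)
definition ulam_step :: "nat \<Rightarrow> (int \<times> int) set \<Rightarrow> (int \<times> int) set \<Rightarrow> bool"
  where "ulam_step n A B \<longleftrightarrow>
    (if ulam_candidates n A = {} then B = A
     else \<exists>z\<in>ulam_candidates n A.
            (\<forall>w\<in>ulam_candidates n A. size_of z \<le> size_of w) \<and> B = insert z A)"

(* U is the result of the construction from S, for some way of breaking the ties. *)
definition ulam_from :: "nat \<Rightarrow> (int \<times> int) set \<Rightarrow> (int \<times> int) set \<Rightarrow> bool"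
  where "ulam_from n S U \<longleftrightarrow>
    (\<exists>A :: nat \<Rightarrow> (int \<times> int) set.
       A 0 = S \<and> (\<forall>k. ulam_step n (A k) (A (Suc k))) \<and> U = (\<Union>k. A k))"

definition ulam_set :: "nat \<Rightarrow> (int \<times> int) set \<Rightarrow> bool"
  where "ulam_set n U \<longleftrightarrow>
    (\<exists>S \<subseteq> carrier (int_times_mod n). finite S \<and> (\<forall>s\<in>S. size_of s > 0) \<and> ulam_from n S U)"

definition regular :: "nat \<Rightarrow> (int \<times> int) set \<Rightarrow> bool"
  where "regular n A \<longleftrightarrow>
    (\<exists>P>0::int. \<forall>\<^sub>F x in at_top. \<forall>y\<in>carrier (integer_mod_group n).
       (x, y) \<in> A \<longleftrightarrow> (x + P, y) \<in> A)"

end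

theory Submission
  imports Defs
begin

text \<open>
  Beyond the sizes of the initial elements, an Ulam set \<open>U\<close> consists exactly of the elements
  that have a unique representation as a sum of two distinct elements of \<open>U\<close>
  (\<open>ulam_set_eventually_unique\<close>), because the construction proceeds in order of size and
  summands are smaller than sums.  Both directions rest on this description.

  If \<open>U\<close> is regular with period \<open>P\<close>, then two elements far out in \<open>U\<close> can be moved
  apart by \<open>P\<close> and by \<open>2 * P\<close> without changing their sum.  The sum then has at least two
  representations, so it is not in \<open>U\<close>: a tail of \<open>U\<close> is sum-free, and it serves as \<open>E\<close>.

  Conversely, let \<open>E\<close> be regular and sum-free, with \<open>F = U - E\<close> finite.  A large element \<open>z\<close>
  of \<open>E\<close> is not the sum of two elements of \<open>E\<close>, so each of its representations
  uses a summand from \<open>F\<close>; the other summand then lies in a window of bounded length just below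
  \<open>z\<close>.  Hence a layer of \<open>U\<close> is determined by the layer of \<open>E\<close> at the same size and by boundedly
  many preceding layers of \<open>U\<close> (\<open>mem_iff_unique_exceptional_summand\<close>).  There are only finitely
  many possible layers, since the second coordinate lives in a finite group, and the layers of \<open>E\<close>
  are periodic; so \<open>U\<close> is produced by a finite automaton with periodic input, and some state
  recurs (\<open>finite_memory_imp_eventually_periodic\<close>).
\<close>

section \<open>Arithmetic in the group\<close>

lemma mult_int_times_mod:
  "p \<otimes>\<^bsub>int_times_mod n\<^esub> q = (fst p + fst q, (snd p + snd q) mod int n)"
  by (simp add: mult_DirProd')

lemma mult_int_times_mod_commute:
  "p \<otimes>\<^bsub>int_times_mod n\<^esub> q = q \<otimes>\<^bsub>int_times_mod n\<^esub> p"
  by (simp add: mult_int_times_mod add.commute)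

lemma mult_int_times_mod_left_cancel:
  assumes "f \<in> carrier (int_times_mod n)" "u \<in> carrier (int_times_mod n)"
    and "v \<in> carrier (int_times_mod n)"
    and "f \<otimes>\<^bsub>int_times_mod n\<^esub> u = f \<otimes>\<^bsub>int_times_mod n\<^esub> v"
  shows "u = v"
proof -
  interpret group "int_times_mod n"
    by (intro DirProd_group) simp_all
  show ?thesis
    using assms Units_l_cancel Units_eq by blast
qed

lemma finite_carrier_bounded_size:
  assumes "n \<ge> 1"
  shows "finite {z \<in> carrier (int_times_mod n). size_of z \<in> {a..b}}"
proof (rule finite_subset)
  show "{z \<in> carrier (int_times_mod n). size_of z \<in> {a..b}} \<subseteq> {a..b} \<times> {0..<int n}"
    using assms by (auto simp: size_of_def carrier_integer_mod_group)
qed simp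

section \<open>Unique representation in an Ulam set\<close>

definition representations :: "nat \<Rightarrow> (int \<times> int) set \<Rightarrow> int \<times> int \<Rightarrow> (int \<times> int) set set"
  where "representations n A z =
    {{p, q} | p q. p \<in> A \<and> q \<in> A \<and> p \<noteq> q \<and> z = p \<otimes>\<^bsub>int_times_mod n\<^esub> q}"

lemma uniquely_represented_iff:
  "uniquely_represented n A z \<longleftrightarrow> (\<exists>!R. R \<in> representations n A z)"
proof -
  have "(\<exists>p\<in>A. \<exists>q\<in>A. p \<noteq> q \<and> R = {p, q} \<and> z = p \<otimes>\<^bsub>int_times_mod n\<^esub> q)
      \<longleftrightarrow> R \<in> representations n A z" for R
    unfolding representations_def by blast
  then show ?thesis
    unfolding uniquely_represented_def by simp
qed

lemma representations_mono: "A \<subseteq> B \<Longrightarrow> representations n A z \<subseteq> representations n B z"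
  unfolding representations_def by blast

text \<open>
  As sizes are positive, a summand is strictly smaller than the sum.  So elements of size at
  least \<open>t\<close> cannot affect representations of elements of size at most \<open>t\<close>.
\<close>

lemma representations_extend_above:
  assumes "A \<subseteq> B" and pos: "\<forall>b\<in>B. size_of b > 0"
    and above: "\<forall>b\<in>B - A. t \<le> size_of b" and "size_of z \<le> t"
  shows "representations n B z = representations n A z"
proof
  show "representations n B z \<subseteq> representations n A z"
  proof
    fix R assume "R \<in> representations n B z"
    then obtain p q where pq: "p \<in> B" "q \<in> B" "p \<noteq> q" "R = {p, q}"
        "z = p \<otimes>\<^bsub>int_times_mod n\<^esub> q"
      unfolding representations_def by blast
    have "size_of p < t" "size_of q < t"
      using pq pos \<open>size_of z \<le> t\<close> by (force simp: size_of_def mult_int_times_mod)+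
    then have "p \<in> A" "q \<in> A"
      using pq above by force+
    then show "R \<in> representations n A z"
      using pq unfolding representations_def by blast
  qed
qed (use assms representations_mono in blast)

lemma ulam_step_invariant:
  assumes "ulam_step n A B"
    and "A \<subseteq> carrier (int_times_mod n)" and "\<forall>a\<in>A. size_of a > 0"
  shows "A \<subseteq> B" and "B \<subseteq> carrier (int_times_mod n)" and "\<forall>b\<in>B. size_of b > 0"
proof -
  have "size_of z > 0" if z: "z \<in> ulam_candidates n A" for z
  proof -
    obtain R where "R \<in> representations n A z"
      using z unfolding ulam_candidates_def uniquely_represented_iff by blast
    then obtain p q where "p \<in> A" "q \<in> A" "z = p \<otimes>\<^bsub>int_times_mod n\<^esub> q"
      unfolding representations_def by blast
    then show ?thesis
      using assms(3) by (auto simp: size_of_def mult_int_times_mod intro: add_pos_pos)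
  qed
  then show "A \<subseteq> B" "B \<subseteq> carrier (int_times_mod n)" "\<forall>b\<in>B. size_of b > 0"
    using assms unfolding ulam_step_def ulam_candidates_def
    by (auto split: if_splits)
qed

text \<open>
  The construction never goes back to a size it has passed: a new candidate is a sum that
  involves the newest element, so it is larger than that element.
\<close>

lemma ulam_step_candidates_above:
  assumes step: "ulam_step n A B"
    and A: "A \<subseteq> carrier (int_times_mod n)" "\<forall>a\<in>A. size_of a > 0"
    and above: "\<forall>w\<in>ulam_candidates n A. t \<le> size_of w"
  shows "\<forall>b\<in>B - A. t \<le> size_of b" and "\<forall>w\<in>ulam_candidates n B. t \<le> size_of w"
proof -
  note B = ulam_step_invariant[OF step A]
  show new: "\<forall>b\<in>B - A. t \<le> size_of b"
    using step above unfolding ulam_step_def by (auto split: if_splits)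
  show "\<forall>w\<in>ulam_candidates n B. t \<le> size_of w"
  proof (intro ballI, rule ccontr)
    fix w assume w: "w \<in> ulam_candidates n B" "\<not> t \<le> size_of w"
    then have "representations n B w = representations n A w"
      using representations_extend_above[OF B(1) B(3) new] by simp
    then have "w \<in> ulam_candidates n A"
      using w B(1) unfolding ulam_candidates_def uniquely_represented_iff by auto
    then show False
      using above w by blast
  qed
qed

locale ulam_construction =
  fixes n :: nat and S :: "(int \<times> int) set" and A :: "nat \<Rightarrow> (int \<times> int) set"
  assumes S_carrier: "S \<subseteq> carrier (int_times_mod n)"
    and S_pos: "\<forall>s\<in>S. size_of s > 0"
    and start: "A 0 = S"
    and step: "\<And>k. ulam_step n (A k) (A (Suc k))"
begin

lemma stage_invariant: "A k \<subseteq> carrier (int_times_mod n) \<and> (\<forall>a\<in>A k. size_of a > 0)"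
proof (induction k)
  case 0
  then show ?case
    using S_carrier S_pos start by simp
next
  case (Suc k)
  then show ?case
    using ulam_step_invariant[OF step] by blast
qed

lemma stage_mono:
  assumes "j \<le> k"
  shows "A j \<subseteq> A k"
proof -
  have "A i \<subseteq> A (Suc i)" for i
    using ulam_step_invariant(1)[OF step] stage_invariant by blast
  then show ?thesis
    using assms by (rule lift_Suc_mono_le)
qed

lemma later_candidates_above:
  assumes "\<forall>w\<in>ulam_candidates n (A k). t \<le> size_of w" and "k \<le> j"
  shows "(\<forall>w\<in>ulam_candidates n (A j). t \<le> size_of w) \<and> (\<forall>b\<in>A j - A k. t \<le> size_of b)"
  using \<open>k \<le> j\<close>
proof (induction j rule: dec_induct)
  case base
  then show ?case
    using assms(1) by simp
next
  case (step j)
  then show ?case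
    using ulam_step_candidates_above[OF ulam_construction.step[OF ulam_construction_axioms], of j t]
      stage_invariant[of j] by blast
qed

text \<open>
  At the stage where \<open>z\<close> is added it has one representation; everything added later is at least
  as large as \<open>z\<close>, hence not a summand of \<open>z\<close>.
\<close>

lemma added_imp_uniquely_represented:
  assumes "z \<in> (\<Union>k. A k)" and "z \<notin> S"
  shows "uniquely_represented n (\<Union>k. A k) z"
proof -
  define k where "k = (LEAST k. z \<in> A k)"
  have "z \<in> A k"
    unfolding k_def using assms(1) by (auto intro: LeastI)
  with \<open>z \<notin> S\<close> start obtain j where j: "k = Suc j"
    by (metis not0_implies_Suc)
  then have "z \<notin> A j"
    using not_less_Least[of j "\<lambda>k. z \<in> A k"] unfolding k_def by simp
  with \<open>z \<in> A k\<close> j step[of j] have z: "z \<in> ulam_candidates n (A j)"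
      "\<forall>w\<in>ulam_candidates n (A j). size_of z \<le> size_of w"
    unfolding ulam_step_def by (auto split: if_splits)
  have "\<forall>b\<in>(\<Union>k. A k) - A j. size_of z \<le> size_of b"
  proof (intro ballI, elim DiffE UN_E)
    fix b i assume "b \<in> A i" "b \<notin> A j"
    then show "size_of z \<le> size_of b"
      using later_candidates_above[OF z(2), of i] stage_mono[of i j] by (cases "j \<le> i") auto
  qed
  then have "representations n (\<Union>k. A k) z = representations n (A j) z"
    using stage_invariant by (intro representations_extend_above[where t = "size_of z"]) auto
  then show ?thesis
    using z(1) unfolding ulam_candidates_def uniquely_represented_iff by simp
qed

text \<open>
  If \<open>z\<close> were never added, it would stay a candidate from some stage on, and every later stage
  would add an element no larger than \<open>z\<close>; there are not enough such elements.
\<close>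

lemma uniquely_represented_imp_added:
  assumes "n \<ge> 1" and z: "z \<in> carrier (int_times_mod n)"
    and unique: "uniquely_represented n (\<Union>k. A k) z"
  shows "z \<in> (\<Union>k. A k)"
proof (rule ccontr)
  assume notin: "z \<notin> (\<Union>k. A k)"
  obtain R where "R \<in> representations n (\<Union>k. A k) z"
    using unique unfolding uniquely_represented_iff by blast
  then obtain p q i j where pq: "p \<in> A i" "q \<in> A j" "p \<noteq> q" "R = {p, q}"
      "z = p \<otimes>\<^bsub>int_times_mod n\<^esub> q"
    unfolding representations_def by blast
  define k where "k = max i j"
  have candidate: "z \<in> ulam_candidates n (A l)" if "k \<le> l" for l
  proof -
    have "p \<in> A l" "q \<in> A l"
      using pq stage_mono[of i l] stage_mono[of j l] that unfolding k_def by auto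
    then have "R \<in> representations n (A l) z"
      using pq unfolding representations_def by blast
    moreover have "representations n (A l) z \<subseteq> representations n (\<Union>k. A k) z"
      by (intro representations_mono) auto
    ultimately have "uniquely_represented n (A l) z"
      using unique unfolding uniquely_represented_iff by blast
    then show ?thesis
      using notin z unfolding ulam_candidates_def by blast
  qed
  let ?small = "{w \<in> carrier (int_times_mod n). size_of w \<in> {1..size_of z}}"
  have grows: "\<exists>w. w \<in> ?small \<inter> A (Suc l) - A l" if l: "k \<le> l" for l
  proof -
    obtain w where w: "w \<in> ulam_candidates n (A l)"
        "\<forall>v\<in>ulam_candidates n (A l). size_of w \<le> size_of v" "A (Suc l) = insert w (A l)"
      using candidate[OF l] step[of l] unfolding ulam_step_def by (auto split: if_splits)
    have "size_of w > 0"
      using w(3) stage_invariant[of "Suc l"] by blast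
    moreover have "w \<in> carrier (int_times_mod n)" "w \<notin> A l"
      using w(1) unfolding ulam_candidates_def by blast+
    ultimately have "w \<in> ?small \<inter> A (Suc l) - A l"
      using w(2,3) candidate[OF l] by simp
    then show ?thesis ..
  qed
  have fin: "finite ?small"
    using \<open>n \<ge> 1\<close> by (rule finite_carrier_bounded_size)
  have "i \<le> card (?small \<inter> A (k + i))" for i
  proof (induction i)
    case (Suc i)
    have "?small \<inter> A (k + i) \<subset> ?small \<inter> A (k + Suc i)"
      using grows[of "k + i"] stage_mono[of "k + i" "k + Suc i"] by auto
    then have "card (?small \<inter> A (k + i)) < card (?small \<inter> A (k + Suc i))"
      using fin by (intro psubset_card_mono) auto
    then show ?case
      using Suc by simp
  qed simp
  from this[of "Suc (card ?small)"] card_mono[OF fin, of "?small \<inter> A (k + Suc (card ?small))"]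
  show False
    by auto
qed

end

lemma ulam_set_eventually_unique:
  assumes "n \<ge> 1" and "ulam_set n U"
  obtains b where "U \<subseteq> carrier (int_times_mod n)" and "\<forall>u\<in>U. size_of u > 0"
    and "\<And>z. z \<in> carrier (int_times_mod n) \<Longrightarrow> b < size_of z \<Longrightarrow>
          z \<in> U \<longleftrightarrow> uniquely_represented n U z"
proof -
  obtain S A where S: "S \<subseteq> carrier (int_times_mod n)" "finite S" "\<forall>s\<in>S. size_of s > 0"
    and A: "A 0 = S" "\<forall>k. ulam_step n (A k) (A (Suc k))" and U: "U = (\<Union>k. A k)"
    using assms(2) unfolding ulam_set_def ulam_from_def by blast
  interpret ulam_construction n S A
    by unfold_locales (use S A in auto)
  define b where "b = Max (insert 0 (size_of ` S))"
  have "z \<notin> S" if "b < size_of z" for z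
    using that S(2) Max_ge[of "insert 0 (size_of ` S)" "size_of z"] unfolding b_def by auto
  then have "z \<in> U \<longleftrightarrow> uniquely_represented n U z"
    if "z \<in> carrier (int_times_mod n)" "b < size_of z" for z
    using that added_imp_uniquely_represented[of z]
      uniquely_represented_imp_added[OF assms(1), of z] unfolding U by blast
  moreover have "U \<subseteq> carrier (int_times_mod n)" "\<forall>u\<in>U. size_of u > 0"
    using stage_invariant unfolding U by blast+
  ultimately show ?thesis
    using that by blast
qed

section \<open>A tail of a regular Ulam set is sum-free\<close>

text \<open>
  Moving \<open>e1\<close> down and \<open>e2\<close> up by the same multiple of the period keeps their sum.  The
  smaller summand goes down, so that the summands stay distinct; two such moves are used
  because \<open>e1 = e2\<close> is possible, and then the unmoved pair is not a representation.
\<close>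

lemma sum_not_uniquely_represented:
  assumes "P > 0" and periodic: "\<And>x y. N \<le> x \<Longrightarrow> y \<in> carrier (integer_mod_group n) \<Longrightarrow>
      (x, y) \<in> U \<longleftrightarrow> (x + P, y) \<in> U"
    and "U \<subseteq> carrier (int_times_mod n)" and "e1 \<in> U" "e2 \<in> U"
    and "N + 2 * P \<le> size_of e1" and "size_of e1 \<le> size_of e2"
  shows "\<not> uniquely_represented n U (e1 \<otimes>\<^bsub>int_times_mod n\<^esub> e2)"
proof
  let ?z = "e1 \<otimes>\<^bsub>int_times_mod n\<^esub> e2"
  assume unique: "uniquely_represented n U ?z"
  obtain x1 y1 x2 y2 where e: "e1 = (x1, y1)" "e2 = (x2, y2)"
    by fastforce
  have y: "y1 \<in> carrier (integer_mod_group n)" "y2 \<in> carrier (integer_mod_group n)"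
    using assms e by auto
  have x: "N + 2 * P \<le> x1" "x1 \<le> x2"
    using assms e by (auto simp: size_of_def)
  have moved: "(x1 - P, y1) \<in> U" "(x2 + P, y2) \<in> U"
    using periodic[of "x1 - P" y1] periodic[of x2 y2] x y \<open>P > 0\<close> \<open>e1 \<in> U\<close> \<open>e2 \<in> U\<close>
    unfolding e by auto
  then have moved2: "(x1 - 2 * P, y1) \<in> U" "(x2 + 2 * P, y2) \<in> U"
    using periodic[of "x1 - 2 * P" y1] periodic[of "x2 + P" y2] x y \<open>P > 0\<close>
    by (auto simp: algebra_simps)
  have "{(x1 - P, y1), (x2 + P, y2)} \<in> representations n U ?z"
    using moved x \<open>P > 0\<close> unfolding representations_def e mult_int_times_mod by fastforce
  moreover have "{(x1 - 2 * P, y1), (x2 + 2 * P, y2)} \<in> representations n U ?z"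
    using moved2 x \<open>P > 0\<close> unfolding representations_def e mult_int_times_mod by fastforce
  moreover have "{(x1 - P, y1), (x2 + P, y2)} \<noteq> {(x1 - 2 * P, y1), (x2 + 2 * P, y2)}"
    using x \<open>P > 0\<close> by (auto simp: doubleton_eq_iff)
  ultimately show False
    using unique unfolding uniquely_represented_iff by blast
qed

lemma regular_imp_sum_free_tail:
  assumes "n \<ge> 1" and "ulam_set n U" and "regular n U"
  shows "\<exists>E \<subseteq> carrier (int_times_mod n).
       regular n E \<and>
       (\<forall>e1\<in>E. \<forall>e2\<in>E. e1 \<otimes>\<^bsub>int_times_mod n\<^esub> e2 \<notin> E) \<and>
       finite (U - E)"
proof -
  obtain b where U: "U \<subseteq> carrier (int_times_mod n)" "\<forall>u\<in>U. size_of u > 0"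
    and b: "\<And>z. z \<in> carrier (int_times_mod n) \<Longrightarrow> b < size_of z \<Longrightarrow>
          z \<in> U \<longleftrightarrow> uniquely_represented n U z"
    using ulam_set_eventually_unique[OF assms(1,2)] by blast
  obtain P N where "P > 0" and periodic: "\<And>x y. N \<le> x \<Longrightarrow>
      y \<in> carrier (integer_mod_group n) \<Longrightarrow> (x, y) \<in> U \<longleftrightarrow> (x + P, y) \<in> U"
    using assms(3) unfolding regular_def eventually_at_top_linorder by blast
  define M where "M = max (N + 2 * P) b"
  define E where "E = {u \<in> U. M \<le> size_of u}"
  have not_unique: "\<not> uniquely_represented n U (e1 \<otimes>\<^bsub>int_times_mod n\<^esub> e2)"
    if "e1 \<in> E" "e2 \<in> E" "size_of e1 \<le> size_of e2" for e1 e2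
    using that sum_not_uniquely_represented[OF \<open>P > 0\<close> periodic U(1)]
    unfolding E_def M_def by auto
  have "e1 \<otimes>\<^bsub>int_times_mod n\<^esub> e2 \<notin> E" if e: "e1 \<in> E" "e2 \<in> E" for e1 e2
  proof
    let ?z = "e1 \<otimes>\<^bsub>int_times_mod n\<^esub> e2"
    assume "?z \<in> E"
    moreover have "b < size_of ?z"
      using e U(2) unfolding E_def M_def by (fastforce simp: size_of_def mult_int_times_mod)
    ultimately have "uniquely_represented n U ?z"
      using b U(1) unfolding E_def by blast
    then show False
      using not_unique[of e1 e2] not_unique[of e2 e1] e
        mult_int_times_mod_commute[of n e1 e2] by fastforce
  qed
  moreover have "regular n E"
    unfolding regular_def
  proof (intro exI conjI)
    show "\<forall>\<^sub>F x in at_top. \<forall>y\<in>carrier (integer_mod_group n). (x, y) \<in> E \<longleftrightarrow> (x + P, y) \<in> E"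
      using eventually_ge_at_top[of M]
    proof eventually_elim
      case (elim x)
      then show ?case
        using periodic[of x] \<open>P > 0\<close> unfolding E_def M_def by (auto simp: size_of_def)
    qed
  qed fact
  moreover have "finite (U - E)"
    by (rule finite_subset[OF _ finite_carrier_bounded_size[OF assms(1), of 1 M]])
      (use U in \<open>force simp: E_def\<close>)
  ultimately show ?thesis
    using U(1) by (intro exI[of _ E]) (auto simp: E_def)
qed

section \<open>Sequences with finite memory\<close>

text \<open>
  Pigeonhole on the blocks of length \<open>m\<close> that start at \<open>x0, x0 + P, x0 + 2 * P, ...\<close>: once
  two blocks agree, the rule for the next value keeps the sequence in step forever.
\<close>

lemma finite_memory_imp_eventually_periodic:
  fixes f :: "int \<Rightarrow> 'a" and m :: nat
  assumes "P > 0" and "finite (range f)"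
    and memory: "\<And>x x'. x0 \<le> x \<Longrightarrow> x \<le> x' \<Longrightarrow> P dvd x' - x \<Longrightarrow>
      (\<And>j. 1 \<le> j \<Longrightarrow> j \<le> int m \<Longrightarrow> f (x - j) = f (x' - j)) \<Longrightarrow> f x = f x'"
  obtains d x1 where "d > 0" and "\<And>x. x1 \<le> x \<Longrightarrow> f x = f (x + d)"
proof -
  define block where "block i = map (\<lambda>j. f (x0 + int i * P + int j)) [0..<m]" for i
  have "range block \<subseteq> {xs. set xs \<subseteq> range f \<and> length xs = m}"
    unfolding block_def by auto
  then have "finite (range block)"
    using finite_lists_length_eq[OF assms(2)] finite_subset by blast
  then have "\<not> inj block"
    using finite_imageD infinite_UNIV_nat by blast
  then obtain i1 i2 where i: "i1 < i2" "block i1 = block i2"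
    unfolding inj_def by (metis linorder_neqE_nat)
  define x1 d where "x1 = x0 + int i1 * P" and "d = (int i2 - int i1) * P"
  have "d > 0"
    using i \<open>P > 0\<close> unfolding d_def by simp
  have "f x = f (x + d)" if "x1 \<le> x" for x
    using that
  proof (induction "nat (x - x1)" arbitrary: x rule: less_induct)
    case less
    show ?case
    proof (cases "x < x1 + int m")
      case True
      define j where "j = nat (x - x1)"
      have "j < m" "x = x1 + int j"
        using True less.prems unfolding j_def by auto
      then have "f x = block i1 ! j" "f (x + d) = block i2 ! j"
        unfolding block_def x1_def d_def by (simp_all add: algebra_simps)
      then show ?thesis
        using i by simp
    next
      case False
      show ?thesis
      proof (rule memory)
        show "x0 \<le> x"
          using less.prems \<open>P > 0\<close> unfolding x1_def
          by (smt (verit) mult_nonneg_nonneg of_nat_0_le_iff)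
        fix j :: int assume "1 \<le> j" "j \<le> int m"
        then show "f (x - j) = f (x + d - j)"
          using less.hyps[of "x - j"] False by (simp add: algebra_simps)
      qed (use \<open>d > 0\<close> in \<open>auto simp: d_def\<close>)
    qed
  qed
  then show ?thesis
    using that \<open>d > 0\<close> by blast
qed

section \<open>A sum-free set containing almost all of the Ulam set\<close>

text \<open>
  Sum-freeness forces every representation of \<open>z\<close> to use a summand outside \<open>E\<close>.  As \<open>z\<close> is too
  large to be a sum of two such summands, the exceptional summand identifies the representation.
\<close>

lemma mem_iff_unique_exceptional_summand:
  assumes U: "U \<subseteq> carrier (int_times_mod n)"
    and sum_free: "\<And>e1 e2. e1 \<in> E \<Longrightarrow> e2 \<in> E \<Longrightarrow> e1 \<otimes>\<^bsub>int_times_mod n\<^esub> e2 \<notin> E"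
    and bound: "\<And>f. f \<in> U - E \<Longrightarrow> size_of f \<le> m" and "0 \<le> m"
    and large: "2 * m < size_of z"
    and z: "z \<in> U \<longleftrightarrow> uniquely_represented n U z"
  shows "z \<in> U \<longleftrightarrow>
    z \<in> E \<and> (\<exists>!f. f \<in> U - E \<and> (\<exists>u\<in>U. z = f \<otimes>\<^bsub>int_times_mod n\<^esub> u))"
proof (cases "z \<in> E")
  case False
  then show ?thesis
    using bound[of z] large \<open>0 \<le> m\<close> by auto
next
  case True
  let ?summand = "\<lambda>f. f \<in> U - E \<and> (\<exists>u\<in>U. z = f \<otimes>\<^bsub>int_times_mod n\<^esub> u)"
  have large_cofactor: "u \<notin> U - E"
    if "f \<in> U - E" "z = f \<otimes>\<^bsub>int_times_mod n\<^esub> u" for f u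
    using that bound[of f] bound[of u] large by (auto simp: size_of_def mult_int_times_mod)
  have rep: "{f, u} \<in> representations n U z"
    if "f \<in> U - E" "u \<in> U" "z = f \<otimes>\<^bsub>int_times_mod n\<^esub> u" for f u
    using that large_cofactor[of f u] unfolding representations_def by blast
  have rep_cases: "\<exists>f u. R = {f, u} \<and> f \<in> U - E \<and> u \<in> U \<and> z = f \<otimes>\<^bsub>int_times_mod n\<^esub> u"
    if "R \<in> representations n U z" for R
  proof -
    obtain p q where pq: "p \<in> U" "q \<in> U" "R = {p, q}" "z = p \<otimes>\<^bsub>int_times_mod n\<^esub> q"
      using \<open>R \<in> representations n U z\<close> unfolding representations_def by blast
    then have "p \<notin> E \<or> q \<notin> E"
      using sum_free True by blast
    then show ?thesis
      using pq mult_int_times_mod_commute[of n p q] by blast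
  qed
  have "(\<exists>!R. R \<in> representations n U z) \<longleftrightarrow> (\<exists>!f. ?summand f)"
  proof
    assume "\<exists>!R. R \<in> representations n U z"
    then obtain R where R: "R \<in> representations n U z"
      and only: "\<forall>R'. R' \<in> representations n U z \<longrightarrow> R' = R"
      by (rule ex1E)
    obtain f u where fu: "f \<in> U - E" "u \<in> U" "z = f \<otimes>\<^bsub>int_times_mod n\<^esub> u"
      using rep_cases[OF R] by (elim exE conjE)
    have "f' = f" if f': "?summand f'" for f'
    proof -
      obtain u' where u': "u' \<in> U" "z = f' \<otimes>\<^bsub>int_times_mod n\<^esub> u'"
        using f' by blast
      have "{f', u'} \<in> representations n U z"
        using f' u' by (intro rep) simp_all
      then have "{f', u'} = {f, u}"
        using only rep[OF fu] by metis
      then show ?thesis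
        using f' large_cofactor[OF fu(1) fu(3)] by (auto simp: doubleton_eq_iff)
    qed
    with fu show "\<exists>!f. ?summand f"
      by (intro ex1I[of _ f]) (blast, simp)
  next
    assume "\<exists>!f. ?summand f"
    then obtain f where f: "?summand f" and only: "\<forall>f'. ?summand f' \<longrightarrow> f' = f"
      by (rule ex1E)
    from f obtain u where fu: "f \<in> U - E" "u \<in> U" "z = f \<otimes>\<^bsub>int_times_mod n\<^esub> u"
      by blast
    have "R = {f, u}" if R: "R \<in> representations n U z" for R
    proof -
      obtain f' u' where f'u': "R = {f', u'}" "f' \<in> U - E" "u' \<in> U"
          "z = f' \<otimes>\<^bsub>int_times_mod n\<^esub> u'"
        using rep_cases[OF R] by blast
      then have "f' = f"
        using only by blast
      moreover from this have "u' = u"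
        using mult_int_times_mod_left_cancel[of f n u' u] fu f'u' U by auto
      ultimately show ?thesis
        using f'u' by simp
    qed
    with rep[OF fu] show "\<exists>!R. R \<in> representations n U z"
      by (rule ex1I)
  qed
  then show ?thesis
    using z True unfolding uniquely_represented_iff by simp
qed

lemma sum_free_superset_imp_regular:
  assumes "n \<ge> 1" and "ulam_set n U" and "regular n E"
    and sum_free: "\<And>e1 e2. e1 \<in> E \<Longrightarrow> e2 \<in> E \<Longrightarrow> e1 \<otimes>\<^bsub>int_times_mod n\<^esub> e2 \<notin> E"
    and "finite (U - E)"
  shows "regular n U"
proof -
  obtain b where U: "U \<subseteq> carrier (int_times_mod n)" "\<forall>u\<in>U. size_of u > 0"
    and b: "\<And>z. z \<in> carrier (int_times_mod n) \<Longrightarrow> b < size_of z \<Longrightarrow>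
          z \<in> U \<longleftrightarrow> uniquely_represented n U z"
    using ulam_set_eventually_unique[OF assms(1,2)] by blast
  obtain P N where "P > 0" and periodic: "\<And>x y. N \<le> x \<Longrightarrow>
      y \<in> carrier (integer_mod_group n) \<Longrightarrow> (x, y) \<in> E \<longleftrightarrow> (x + P, y) \<in> E"
    using assms(3) unfolding regular_def eventually_at_top_linorder by blast
  have periodic_multiple: "(x, y) \<in> E \<longleftrightarrow> (x + int k * P, y) \<in> E"
    if "N \<le> x" "y \<in> carrier (integer_mod_group n)" for x y k
  proof (induction k)
    case (Suc k)
    have "N \<le> x + int k * P"
      using that \<open>P > 0\<close> by (smt (verit) mult_nonneg_nonneg of_nat_0_le_iff)
    then show ?case
      using Suc periodic[of "x + int k * P" y] that by (simp add: algebra_simps)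
  qed simp
  define m where "m = nat (Max (insert 0 (size_of ` (U - E))))"
  have m: "size_of f \<le> int m" if "f \<in> U - E" for f
    using that \<open>finite (U - E)\<close> Max_ge[of "insert 0 (size_of ` (U - E))" "size_of f"]
    unfolding m_def by auto
  define layer where "layer x = {y. (x, y) \<in> U}" for x
  have "range layer \<subseteq> Pow {0..<int n}"
    using U(1) \<open>n \<ge> 1\<close> unfolding layer_def by (auto simp: carrier_integer_mod_group)
  then have "finite (range layer)"
    by (rule finite_subset) simp
  define x0 where "x0 = max N (max (b + 1) (2 * int m + 1))"
  obtain d x1 where "d > 0" and layer: "\<And>x. x1 \<le> x \<Longrightarrow> layer x = layer (x + d)"
  proof (rule finite_memory_imp_eventually_periodic[OF \<open>P > 0\<close> \<open>finite (range layer)\<close>,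
        where m = m and ?x0.0 = x0])
    fix x x' :: int
    assume x: "x0 \<le> x" "x \<le> x'" "P dvd x' - x"
      and window: "\<And>j. 1 \<le> j \<Longrightarrow> j \<le> int m \<Longrightarrow> layer (x - j) = layer (x' - j)"
    obtain c where c: "x' - x = P * c"
      using x by blast
    then have "c \<ge> 0"
      using x \<open>P > 0\<close> by (metis diff_ge_0_iff_ge zero_le_mult_iff not_less)
    then have x': "x' = x + int (nat c) * P"
      using c by (simp add: algebra_simps)
    have same_layer_of_E: "(x, y) \<in> E \<longleftrightarrow> (x', y) \<in> E"
      if "y \<in> carrier (integer_mod_group n)" for y
      unfolding x' by (rule periodic_multiple) (use that x in \<open>auto simp: x0_def\<close>)
    have same_summands: "(\<exists>u\<in>U. (x, y) = f \<otimes>\<^bsub>int_times_mod n\<^esub> u) \<longleftrightarrow>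
        (\<exists>u\<in>U. (x', y) = f \<otimes>\<^bsub>int_times_mod n\<^esub> u)" if "f \<in> U - E" for f y
    proof -
      have "layer (x - fst f) = layer (x' - fst f)"
        using window[of "fst f"] m[OF that] U(2) that by (force simp: size_of_def)
      then have "(x - fst f, v) \<in> U \<longleftrightarrow> (x' - fst f, v) \<in> U" for v
        unfolding layer_def by auto
      moreover have "(\<exists>u\<in>U. (a, y) = f \<otimes>\<^bsub>int_times_mod n\<^esub> u) \<longleftrightarrow>
          (\<exists>v. (a - fst f, v) \<in> U \<and> y = (snd f + v) mod int n)" for a
        by (force simp: mult_int_times_mod)
      ultimately show ?thesis
        by simp
    qed
    have layer_iff: "(a, y) \<in> U \<longleftrightarrow>
        (a, y) \<in> E \<and> (\<exists>!f. f \<in> U - E \<and> (\<exists>u\<in>U. (a, y) = f \<otimes>\<^bsub>int_times_mod n\<^esub> u))"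
      if "x0 \<le> a" "y \<in> carrier (integer_mod_group n)" for a y
      using that m
      by (intro mem_iff_unique_exceptional_summand[OF U(1) sum_free, where m = "int m"] b)
        (auto simp: x0_def size_of_def)
    have "(x, y) \<in> U \<longleftrightarrow> (x', y) \<in> U" if y: "y \<in> carrier (integer_mod_group n)" for y
    proof -
      have "f \<in> U - E \<and> (\<exists>u\<in>U. (x, y) = f \<otimes>\<^bsub>int_times_mod n\<^esub> u) \<longleftrightarrow>
          f \<in> U - E \<and> (\<exists>u\<in>U. (x', y) = f \<otimes>\<^bsub>int_times_mod n\<^esub> u)" for f
        using same_summands by (rule conj_cong[OF refl])
      moreover have "x0 \<le> x'"
        using x by simp
      ultimately show ?thesis
        by (simp only: layer_iff[OF \<open>x0 \<le> x\<close> y] layer_iff[OF _ y] same_layer_of_E[OF y])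
    qed
    then show "layer x = layer x'"
      using U(1) unfolding layer_def by auto
  qed blast
  show ?thesis
    unfolding regular_def
  proof (intro exI conjI)
    show "\<forall>\<^sub>F x in at_top. \<forall>y\<in>carrier (integer_mod_group n). (x, y) \<in> U \<longleftrightarrow> (x + d, y) \<in> U"
      using eventually_ge_at_top[of x1]
    proof eventually_elim
      case (elim x)
      then show ?case
        using layer[of x] unfolding layer_def by auto
    qed
  qed fact
qed

section \<open>The criterion for regularity\<close>

theorem theorem4p2:
  fixes n :: nat and U :: "(int \<times> int) set"
  assumes "n \<ge> 1"
    and "ulam_set n U"
  shows "regular n U \<longleftrightarrow>
    (\<exists>E \<subseteq> carrier (int_times_mod n).
       regular n E \<and>
       (\<forall>e1\<in>E. \<forall>e2\<in>E. e1 \<otimes>\<^bsub>int_times_mod n\<^esub> e2 \<notin> E) \<and>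
       finite (U - E))"
  using regular_imp_sum_free_tail[OF assms] sum_free_superset_imp_regular[OF assms] by blast

end
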